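(* Let $n\ge1$ and let $\rho_1,\dots,\rho_n\ge 0$ be average throughput demands. Under the perfect power capture model ($\Delta=0$) with i.i.d. Rayleigh fading and with no CSI available to all nodes, there exists a unique Nash equilibrium point $(p_1,\dots,p_n)\in[0,1]^n$ for the average throughput demands $(\rho_1,\dots,\rho_n)$ if and only if $$\sum_{i=1}^n\rho_i\le 1.$$
   Context: Setting (one time slot): nodes $1,\dots,n$ may transmit to a base station, each with the same power. Let $X_i=|h_i|^2$ be the channel power gain of node $i$; $X_1,\dots,X_n$ are i.i.d. exponential random variables with density $e^{-x}$, $x\ge 0$ (Rayleigh fading). No CSI: node $i$ transmits ($B_i=1$) with probability $p_i\in[0,1]$ and otherwise does not ($B_i=0$), where $B_1,\dots,B_n$ are independent of each other and of $(X_1,\dots,X_n)$. Perfect power capture model ($\Delta=0$): node $i$'s packet is successfully received iff $B_iX_i>\max_{j\neq i}\{B_jX_j\}$ (a maximum over the empty set is read as $0$). The average throughput $r_i(p_i,\mathbf p_{-i})$ of node $i$ is the probability that its packet is successfully received when node $i$ transmits with probability $p_i$ and the others with probabilities $\mathbf p_{-i}=(p_j)_{j\ne i}$. Explicitly, $$r_i(p_i,\mathbf p_{-i})=p_i-\frac12\sum_{j\ne i}p_ip_j+\frac13\sum_{\substack{j<k\\ j,k\ne i}}p_ip_jp_k-\cdots+\frac{(-1)^{n-1}}{n}\prod_{j=1}^np_j .$$ A vector $(p_1,\dots,p_n)\in[0,1]^n$ is a Nash equilibrium point for the throughput demands $(\rho_1,\dots,\rho_n)$ if for every $i$, $$p_i\in\arg\min_{0\le\tilde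 p_i\le1}\{\tilde p_i: r_i(\tilde p_i,\mathbf p_{-i})\ge\rho_i\}.$$ Because $r_i$ is strictly increasing in $p_i$ for fixed $\mathbf p_{-i}$ and vanishes at $p_i=0$, this is equivalent to $r_i(p_i,\mathbf p_{-i})=\rho_i$ for all $i=1,\dots,n$. *)

theory Defs
  imports "HOL-Probability.Probability"
begin

text \<open>
  Nodes are the elements of a finite type \<open>'n\<close>, so the number of nodes is \<open>CARD('n) \<ge> 1\<close>.
  All power gains and all transmission decisions are mutually independent, hence their joint law
  is the product of the marginals. It is used as the sample space of one time slot: an outcome
  is a pair \<open>(X, B)\<close> of the vector of power gains and the vector of transmission decisions.
\<close>

definition fading :: "('n::finite \<Rightarrow> real) measure" where
  "fading = (\<Pi>\<^sub>M i\<in>UNIV. density lborel (\<lambda>x. ennreal (exponential_density 1 x)))"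

definition access :: "('n::finite \<Rightarrow> real) \<Rightarrow> ('n \<Rightarrow> bool) measure" where
  "access p = (\<Pi>\<^sub>M i\<in>UNIV. measure_pmf (bernoulli_pmf (p i)))"

definition slot :: "('n::finite \<Rightarrow> real) \<Rightarrow> (('n \<Rightarrow> real) \<times> ('n \<Rightarrow> bool)) measure" where
  "slot p = fading \<Otimes>\<^sub>M access p"

definition rx_power :: "('n \<Rightarrow> real) \<times> ('n \<Rightarrow> bool) \<Rightarrow> 'n \<Rightarrow> real" where
  "rx_power \<omega> i = of_bool (snd \<omega> i) * fst \<omega> i"

text \<open>The maximum over the empty set of interferers is read as \<open>0\<close>.\<close>

definition interference :: "('n::finite \<Rightarrow> real) \<times> ('n \<Rightarrow> bool) \<Rightarrow> 'n \<Rightarrow> real" where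
  "interference \<omega> i = (if UNIV - {i} = {} then 0 else Max (rx_power \<omega> ` (UNIV - {i})))"

definition throughput :: "'n::finite \<Rightarrow> ('n \<Rightarrow> real) \<Rightarrow> real" where
  "throughput i p = \<P>(\<omega> in slot p. rx_power \<omega> i > interference \<omega> i)"

definition nash_equilibrium :: "('n::finite \<Rightarrow> real) \<Rightarrow> ('n \<Rightarrow> real) \<Rightarrow> bool" where
  "nash_equilibrium \<rho> p \<longleftrightarrow>
     (\<forall>i. p i \<in> {0..1}) \<and>
     (\<forall>i. is_arg_min (\<lambda>t. t) (\<lambda>t. t \<in> {0..1} \<and> throughput i (p(i := t)) \<ge> \<rho> i) (p i))"

lemma prob_space_slot: "prob_space (slot p)"
proof -
  have e: "prob_space (density lborel (\<lambda>x. ennreal (exponential_density 1 x)))"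
    by (rule prob_space_exponential_density) simp
  have f: "prob_space (fading :: ('a \<Rightarrow> real) measure)"
    unfolding fading_def using e by (intro prob_space_PiM)
  have a: "prob_space (access p)"
    unfolding access_def by (intro prob_space_PiM measure_pmf.prob_space_axioms)
  interpret pair_prob_space "fading :: ('a \<Rightarrow> real) measure" "access p"
    using f a by (simp add: pair_prob_space_def pair_sigma_finite_def prob_space_imp_sigma_finite)
  show ?thesis
    unfolding slot_def by (rule prob_space_axioms)
qed

text \<open>The reception event is measurable, so its \<open>measure\<close> is a genuine probability.\<close>

lemma reception_event_sets:
  "{\<omega> \<in> space (slot p). rx_power \<omega> i > interference \<omega> i} \<in> sets (slot p)"
proof -
  have x: "(\<lambda>\<omega>. fst \<omega> j) \<in> borel_measurable (slot p)" for j
  proof -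
    have "(\<lambda>x. x j) \<in> borel_measurable (fading :: ('a \<Rightarrow> real) measure)"
      unfolding fading_def
      using measurable_component_singleton[of j UNIV "\<lambda>_. density lborel (\<lambda>x. ennreal (exponential_density 1 x))"]
      by (simp add: measurable_def)
    then show ?thesis
      unfolding slot_def by simp
  qed
  have b: "(\<lambda>\<omega>. of_bool (snd \<omega> j) :: real) \<in> borel_measurable (slot p)" for j
  proof -
    have "(\<lambda>b. b j) \<in> access p \<rightarrow>\<^sub>M measure_pmf (bernoulli_pmf (p j))"
      unfolding access_def by (rule measurable_component_singleton) simp
    then have "(\<lambda>b. of_bool (b j) :: real) \<in> borel_measurable (access p)"
      using measurable_comp[of _ _ _ "of_bool" borel] by (simp add: comp_def)
    then show ?thesis
      unfolding slot_def by (rule measurable_compose[OF measurable_snd])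
  qed
  have w: "(\<lambda>\<omega>. rx_power \<omega> j) \<in> borel_measurable (slot p)" for j
    unfolding rx_power_def using x b by (intro borel_measurable_times)
  have "(\<lambda>\<omega>. interference \<omega> i) \<in> borel_measurable (slot p)"
    unfolding interference_def using w by (auto intro: borel_measurable_Max)
  with w show ?thesis
    by (intro borel_measurable_less)
qed

end

theory Submission
  imports Defs
begin

text \<open>
  Conditioning on the gain of node \<open>i\<close> gives \<open>r\<^sub>i(p) = p\<^sub>i c\<^sub>i(p)\<close>, where
  \<open>c\<^sub>i(p) = \<integral>\<^sub>0\<^sup>\<infinity> e\<^sup>-\<^sup>x \<Prod>\<^bsub>j\<noteq>i\<^esub> (1 - p\<^sub>j e\<^sup>-\<^sup>x) dx\<close> is positive, does not depend on \<open>p\<^sub>i\<close>, and is strictly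
  decreasing in the other coordinates. The integrand of \<open>\<Sum>\<^sub>i r\<^sub>i(p)\<close> is the derivative of
  \<open>\<Prod>\<^sub>j (1 - p\<^sub>j e\<^sup>-\<^sup>x)\<close>, so \<open>\<Sum>\<^sub>i r\<^sub>i(p) = 1 - \<Prod>\<^sub>j (1 - p\<^sub>j) \<le> 1\<close>, which gives necessity.

  Conversely, the map \<open>p \<mapsto> (min 1 (\<rho>\<^sub>i / c\<^sub>i(p)))\<^sub>i\<close> is monotone on the cube and has a greatest fixed
  point \<open>p\<close>. If \<open>r\<^sub>i(p) < \<rho>\<^sub>i\<close> for some \<open>i\<close>, then \<open>p\<^sub>i = 1\<close> and
  \<open>1 = \<Sum>\<^sub>j r\<^sub>j(p) < \<Sum>\<^sub>j \<rho>\<^sub>j \<le> 1\<close>; hence \<open>p\<close> is an equilibrium. Any equilibrium \<open>q\<close> is a fixed point as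
  well, so \<open>q \<le> p\<close>, and \<open>\<Prod>\<^sub>j (1 - q\<^sub>j) = \<Prod>\<^sub>j (1 - p\<^sub>j)\<close>. If this product is nonzero then \<open>q = p\<close>.
  Otherwise \<open>q\<^sub>j = p\<^sub>j = 1\<close> for some \<open>j\<close>, so \<open>c\<^sub>j(q) = c\<^sub>j(p)\<close>, and strict monotonicity of \<open>c\<^sub>j\<close>
  gives \<open>q = p\<close>.
\<close>

section \<open>The exponential law of a single power gain\<close>

abbreviation exp_law :: "real measure" where
  "exp_law \<equiv> density lborel (\<lambda>x. ennreal (exponential_density 1 x))"

lemma prob_space_exp_law: "prob_space exp_law"
  by (rule prob_space_exponential_density) simp

lemma AE_exp_law_pos: "AE x in exp_law. 0 < x"
  using AE_lborel_singleton[of "0::real"]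
  by (subst AE_density) (auto simp: exponential_density_def elim!: eventually_mono)

lemma emeasure_exp_law_lessThan:
  assumes "0 < y"
  shows "emeasure exp_law {..<y} = ennreal (1 - exp (- y))"
proof -
  \<comment> \<open>The law has no atom at \<open>y\<close>, so the distribution function also
    measures the open ray.\<close>
  have "emeasure exp_law {..<y} = emeasure exp_law {..y}"
    using AE_lborel_singleton[of y]
    by (intro emeasure_eq_AE) (auto simp: AE_density elim!: eventually_mono)
  then show ?thesis
    using assms by (simp add: emeasure_erlang_density erlang_CDF_def)
qed

text \<open>The integrand is the chance that an interferer of gain \<open>x\<close> and access
  probability \<open>q\<close> does not beat level \<open>y\<close>: either \<open>x < y\<close>, or
  it stays idle.\<close>

lemma nn_integral_exp_law_factor:
  assumes "0 < y" "q \<in> {0..1}"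
  shows "(\<integral>\<^sup>+x. (if x < y then 1 else ennreal (1 - q)) \<partial>exp_law) = ennreal (1 - q * exp (- y))"
proof -
  interpret prob_space exp_law by (rule prob_space_exp_law)
  have "(\<integral>\<^sup>+x. (if x < y then 1 else ennreal (1 - q)) \<partial>exp_law) =
      (\<integral>\<^sup>+x. ennreal (1 - q) + ennreal q * indicator {..<y} x \<partial>exp_law)"
    using assms(2) by (intro nn_integral_cong) (auto simp flip: ennreal_plus)
  also have "\<dots> = ennreal (1 - q) + ennreal q * ennreal (1 - exp (- y))"
    using assms emeasure_space_1
    by (simp add: nn_integral_add nn_integral_cmult emeasure_exp_law_lessThan)
  also have "\<dots> = ennreal ((1 - q) + q * (1 - exp (- y)))"
    using assms by (subst ennreal_plus) (auto simp: ennreal_mult)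
  finally show ?thesis by (simp add: algebra_simps)
qed

section \<open>Success probability given transmission, and its monotonicity\<close>

text \<open>The success probability of node \<open>i\<close> given that it transmits: conditioning on its gain
  \<open>x\<close>, node \<open>j\<close> fails to exceed \<open>x\<close> with probability \<open>1 - p j * exp (- x)\<close>.\<close>

definition capture :: "'n::finite \<Rightarrow> ('n \<Rightarrow> real) \<Rightarrow> real" where
  "capture i p = (\<integral>x. (\<Prod>j\<in>UNIV - {i}. 1 - p j * exp (- x)) \<partial>exp_law)"

lemma capture_upd [simp]: "capture i (p(i := t)) = capture i p"
  unfolding capture_def by (intro Bochner_Integration.integral_cong prod.cong) auto

text \<open>Strict positivity fails at \<open>x = 0\<close> for \<open>q = 1\<close>; this is why
  the later bounds hold only almost everywhere.\<close>

lemma survival_factor_bounds: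
  fixes q x :: real
  assumes "q \<in> {0..1}" "0 < x"
  shows "0 < 1 - q * exp (- x)" "1 - q * exp (- x) \<le> 1"
proof -
  have "q * exp (- x) \<le> 1 * exp (- x)"
    using assms by (intro mult_right_mono) auto
  also have "\<dots> < 1" using assms by simp
  finally show "0 < 1 - q * exp (- x)" by simp
  show "1 - q * exp (- x) \<le> 1" using assms by simp
qed

lemma AE_survival_prod:
  assumes "\<forall>j. p j \<in> {0..1}"
  shows "AE x in exp_law. (\<Prod>j\<in>A. 1 - p j * exp (- x)) \<in> {0<..1::real}"
  using AE_exp_law_pos
proof eventually_elim
  case (elim x)
  then have "0 < 1 - p j * exp (- x)" "1 - p j * exp (- x) \<le> 1" for j
    using survival_factor_bounds assms by auto
  then have "0 < (\<Prod>j\<in>A. 1 - p j * exp (- x))" "(\<Prod>j\<in>A. 1 - p j * exp (- x)) \<le> 1"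
    by (blast intro: prod_pos, intro prod_le_1) (auto intro: less_imp_le)
  then show ?case by simp
qed

lemma integrable_survival_prod:
  assumes "\<forall>j. p j \<in> {0..1}"
  shows "integrable exp_law (\<lambda>x. \<Prod>j\<in>A. 1 - p j * exp (- x) :: real)"
proof -
  interpret prob_space exp_law by (rule prob_space_exp_law)
  show ?thesis
  proof (rule integrable_const_bound[where B = 1])
    show "AE x in exp_law. norm (\<Prod>j\<in>A. 1 - p j * exp (- x)) \<le> 1"
      using AE_survival_prod[OF assms, of A] by eventually_elim auto
  qed measurable
qed

lemma capture_pos:
  assumes "\<forall>j. p j \<in> {0..1}"
  shows "0 < capture i p"
proof -
  interpret prob_space exp_law by (rule prob_space_exp_law)
  show ?thesis
    unfolding capture_def
    using AE_survival_prod[OF assms, of "UNIV - {i}"]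
    by (intro expectation_greater integrable_survival_prod[OF assms]) (auto elim!: eventually_mono)
qed

lemma capture_antimono:
  assumes "\<forall>j. p j \<in> {0..1}" "\<forall>j. q j \<in> {0..1}" "\<forall>j. q j \<le> p j"
  shows "capture i p \<le> capture i q"
  unfolding capture_def
proof (intro integral_mono_AE integrable_survival_prod assms)
  show "AE x in exp_law. (\<Prod>j\<in>UNIV - {i}. 1 - p j * exp (- x)) \<le> (\<Prod>j\<in>UNIV - {i}. 1 - q j * exp (- x))"
    using AE_exp_law_pos
  proof eventually_elim
    case (elim x)
    then show ?case
      using survival_factor_bounds[of "p j" x for j] assms
      by (intro prod_mono) (auto intro: less_imp_le mult_right_mono)
  qed
qed

lemma capture_strict_antimono:
  assumes "\<forall>j. p j \<in> {0..1}" "\<forall>j. q j \<in> {0..1}" "\<forall>j. q j \<le> p j" "q k < p k" "k \<noteq> i"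
  shows "capture i p < capture i q"
proof -
  interpret prob_space exp_law by (rule prob_space_exp_law)
  have "AE x in exp_law. (\<Prod>j\<in>UNIV - {i}. 1 - p j * exp (- x)) < (\<Prod>j\<in>UNIV - {i}. 1 - q j * exp (- x))"
    using AE_exp_law_pos
  proof eventually_elim
    case (elim x)
    then show ?case
      using survival_factor_bounds[of "p j" x for j] survival_factor_bounds[of "q j" x for j] assms
      by (intro prod_mono_strict[of k]) (auto intro: less_imp_le mult_right_mono)
  qed
  then show ?thesis
    unfolding capture_def using emeasure_space_1
    by (intro integral_less_AE_space integrable_survival_prod assms) auto
qed

section \<open>The total throughput identity\<close>

lemma sum_mult_capture:
  assumes "\<forall>j. p j \<in> {0..1}"
  shows "(\<Sum>i\<in>UNIV. p i * capture i p) = 1 - (\<Prod>i\<in>UNIV. 1 - p i)"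
proof -
  define F where "F x = (\<Prod>j\<in>UNIV. 1 - p j * exp (- x))" for x :: real
  define f where "f x = (\<Sum>i\<in>UNIV. p i * (\<Prod>j\<in>UNIV - {i}. 1 - p j * exp (- x)))" for x :: real
  have nonneg: "0 \<le> f x" if "0 \<le> x" for x
  proof -
    have "p j * exp (- x) \<le> 1" for j
      using mult_mono[of "p j" 1 "exp (- x)" 1] assms that by auto
    then show ?thesis
      unfolding f_def using assms by (intro sum_nonneg mult_nonneg_nonneg prod_nonneg) auto
  qed
  have [measurable]: "f \<in> borel_measurable borel"
    unfolding f_def by measurable
  have "(\<Sum>i\<in>UNIV. p i * capture i p) = (\<integral>x. f x \<partial>exp_law)"
    unfolding capture_def f_def
    by (simp add: integrable_survival_prod[OF assms] Bochner_Integration.integral_sum)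
  \<comment> \<open>Since \<open>f\<close> is nonnegative on the half-line, the improper integral
    can be evaluated by the fundamental theorem for nonnegative integrands.\<close>
  also have "\<dots> = enn2real (\<integral>\<^sup>+x. ennreal (f x) \<partial>exp_law)"
    using AE_exp_law_pos by (intro integral_eq_nn_integral) (auto intro: nonneg elim!: eventually_mono)
  also have "(\<integral>\<^sup>+x. ennreal (f x) \<partial>exp_law) =
      (\<integral>\<^sup>+x. ennreal (f x * exp (- x)) * indicator {0..} x \<partial>lborel)"
    by (subst nn_integral_density)
       (auto intro!: nn_integral_cong simp: exponential_density_def nonneg ennreal_mult' mult.commute
             split: split_indicator)
  also have "\<dots> = ennreal (1 - F 0)"
  proof (rule nn_integral_FTC_atLeast)
    show "DERIV F x :> f x * exp (- x)" for x
      unfolding F_def f_def sum_distrib_right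
      by (rule DERIV_cong, rule has_field_derivative_prod) (auto intro!: derivative_eq_intros sum.cong)
    \<comment> \<open>As x grows, \<open>exp (- x)\<close> vanishes and every factor tends to
      1.\<close>
    have "(F \<longlongrightarrow> (\<Prod>j\<in>UNIV. 1 - p j * 0)) at_top"
      unfolding F_def
      by (intro tendsto_intros filterlim_compose[OF exp_at_bot] filterlim_uminus_at_bot_at_top)
    then show "(F \<longlongrightarrow> 1) at_top" by simp
  qed (auto intro: nonneg mult_nonneg_nonneg)
  finally have "(\<Sum>i\<in>UNIV. p i * capture i p) = enn2real (ennreal (1 - F 0))" .
  moreover have "F 0 \<le> 1"
    unfolding F_def using assms by (auto intro!: prod_le_1)
  ultimately show ?thesis by (simp add: F_def)
qed

section \<open>Reception event and closed form of the throughput\<close>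

text \<open>The positivity assumption holds almost surely; it makes idle nodes harmless interferers and
  lets a lone transmitter beat the interference \<open>0\<close>.\<close>

lemma reception_iff:
  fixes x :: "'n::finite \<Rightarrow> real"
  assumes "\<forall>j. 0 < x j"
  shows "interference (x, b) i < rx_power (x, b) i \<longleftrightarrow> b i \<and> (\<forall>j. j \<noteq> i \<longrightarrow> b j \<longrightarrow> x j < x i)"
proof (cases "UNIV - {i} = {}")
  case True
  then have "j = i" for j by blast
  then show ?thesis
    using assms True by (simp add: interference_def rx_power_def)
next
  case False
  then have "interference (x, b) i < rx_power (x, b) i \<longleftrightarrow>
      (\<forall>j\<in>UNIV - {i}. rx_power (x, b) j < rx_power (x, b) i)"
    by (auto simp: interference_def)
  also have "\<dots> \<longleftrightarrow> b i \<and> (\<forall>j. j \<noteq> i \<longrightarrow> b j \<longrightarrow> x j < x i)"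
    using assms False by (cases "b i") (auto simp: rx_power_def less_le_not_le of_bool_def)
  finally show ?thesis .
qed

lemma emeasure_bernoulli_pmf_True_False:
  assumes "q \<in> {0..1}"
  shows "emeasure (measure_pmf (bernoulli_pmf q)) {True} = ennreal q"
    and "emeasure (measure_pmf (bernoulli_pmf q)) {False} = ennreal (1 - q)"
  using assms by (simp_all add: emeasure_pmf_single)

lemma emeasure_access_capture:
  fixes p x :: "'n::finite \<Rightarrow> real"
  assumes "\<forall>j. p j \<in> {0..1}"
  shows "emeasure (access p) {b. b i \<and> (\<forall>j. j \<noteq> i \<longrightarrow> b j \<longrightarrow> x j < x i)} =
    ennreal (p i) * (\<Prod>j\<in>UNIV - {i}. if x j < x i then 1 else ennreal (1 - p j))"
proof -
  interpret product_prob_space "\<lambda>j. measure_pmf (bernoulli_pmf (p j))" UNIV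
    by unfold_locales
  \<comment> \<open>For fixed gains the event is a box: node \<open>i\<close> is active, weaker
    nodes are free, and all others are idle.\<close>
  define C where "C j = (if j = i then {True} else if x j < x i then UNIV else {False})" for j
  have "{b. b i \<and> (\<forall>j. j \<noteq> i \<longrightarrow> b j \<longrightarrow> x j < x i)} = Pi\<^sub>E UNIV C"
    by (auto simp: C_def PiE_iff split: if_splits)
  then have "emeasure (access p) {b. b i \<and> (\<forall>j. j \<noteq> i \<longrightarrow> b j \<longrightarrow> x j < x i)} =
      (\<Prod>j\<in>UNIV. emeasure (measure_pmf (bernoulli_pmf (p j))) (C j))"
    by (simp add: access_def emeasure_PiM)
  also have "\<dots> = emeasure (measure_pmf (bernoulli_pmf (p i))) (C i) *
      (\<Prod>j\<in>UNIV - {i}. emeasure (measure_pmf (bernoulli_pmf (p j))) (C j))"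
    by (simp add: prod.remove[of UNIV i])
  also have "\<dots> = ennreal (p i) * (\<Prod>j\<in>UNIV - {i}. if x j < x i then 1 else ennreal (1 - p j))"
    using assms measure_pmf.emeasure_space_1
    by (intro arg_cong2[where f = "(*)"] prod.cong)
       (auto simp: C_def emeasure_bernoulli_pmf_True_False)
  finally show ?thesis .
qed

lemma AE_fading_pos: "AE x in (fading :: ('n::finite \<Rightarrow> real) measure). \<forall>j. 0 < x j"
proof -
  have "AE x in (fading :: ('n \<Rightarrow> real) measure). 0 < x j" for j
    unfolding fading_def
    by (rule AE_PiM_component[OF prob_space_exp_law _ AE_exp_law_pos]) simp
  then show ?thesis by (simp add: AE_all_countable)
qed

text \<open>Tonelli splits off the gain \<open>y\<close> of node \<open>i\<close>; given
  \<open>y\<close>, the other gains are independent, so the integral of the product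
  factorises.\<close>

lemma nn_integral_fading_survival:
  fixes p :: "'n::finite \<Rightarrow> real"
  assumes p: "\<forall>j. p j \<in> {0..1}"
  shows "(\<integral>\<^sup>+x. (\<Prod>j\<in>UNIV - {i}. if x j < x i then 1 else ennreal (1 - p j)) \<partial>fading) =
    ennreal (capture i p)"
proof -
  interpret product_prob_space "\<lambda>_::'n. exp_law" UNIV
    using prob_space_exp_law by (simp add: product_prob_spaceI)
  define h where "h x = (\<Prod>j\<in>UNIV - {i}. if x j < x i then 1 else ennreal (1 - p j))" for x :: "'n \<Rightarrow> real"
  have ins: "insert i (UNIV - {i}) = UNIV" by blast
  have h: "h \<in> borel_measurable (Pi\<^sub>M (insert i (UNIV - {i})) (\<lambda>_. exp_law))"
    unfolding h_def by measurable
  have "(\<integral>\<^sup>+x. h x \<partial>fading) =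
      (\<integral>\<^sup>+y. (\<integral>\<^sup>+x. h (x(i := y)) \<partial>Pi\<^sub>M (UNIV - {i}) (\<lambda>_. exp_law)) \<partial>exp_law)"
    using product_nn_integral_insert_rev[OF _ _ h] by (simp add: fading_def ins del: insert_Diff_single)
  also have "\<dots> = (\<integral>\<^sup>+y. (\<Prod>j\<in>UNIV - {i}. \<integral>\<^sup>+x. (if x < y then 1 else ennreal (1 - p j)) \<partial>exp_law) \<partial>exp_law)"
  proof (rule nn_integral_cong)
    fix y :: real
    have "h (x(i := y)) = (\<Prod>j\<in>UNIV - {i}. if x j < y then 1 else ennreal (1 - p j))" for x
      unfolding h_def by (intro prod.cong) auto
    then show "(\<integral>\<^sup>+x. h (x(i := y)) \<partial>Pi\<^sub>M (UNIV - {i}) (\<lambda>_. exp_law)) =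
        (\<Prod>j\<in>UNIV - {i}. \<integral>\<^sup>+x. (if x < y then 1 else ennreal (1 - p j)) \<partial>exp_law)"
      using product_nn_integral_prod[of "UNIV - {i}" "\<lambda>j x. if x < y then 1 else ennreal (1 - p j)"]
      by simp
  qed
  also have "\<dots> = (\<integral>\<^sup>+y. ennreal (\<Prod>j\<in>UNIV - {i}. 1 - p j * exp (- y)) \<partial>exp_law)"
  proof (rule nn_integral_cong_AE)
    show "AE y in exp_law. (\<Prod>j\<in>UNIV - {i}. \<integral>\<^sup>+x. (if x < y then 1 else ennreal (1 - p j)) \<partial>exp_law) =
        ennreal (\<Prod>j\<in>UNIV - {i}. 1 - p j * exp (- y))"
      using AE_exp_law_pos
    proof eventually_elim
      case (elim y)
      have "0 \<le> 1 - p j * exp (- y)" for j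
        using survival_factor_bounds(1)[of "p j" y] p elim by (simp add: less_imp_le)
      then show ?case
        using p elim by (simp add: nn_integral_exp_law_factor prod_ennreal)
    qed
  qed
  also have "\<dots> = ennreal (capture i p)"
    unfolding capture_def using AE_survival_prod[OF p, of "UNIV - {i}"]
    by (intro nn_integral_eq_integral integrable_survival_prod[OF p]) (auto elim!: eventually_mono)
  finally show ?thesis by (simp add: h_def)
qed

lemma throughput_eq:
  fixes p :: "'n::finite \<Rightarrow> real"
  assumes p: "\<forall>j. p j \<in> {0..1}"
  shows "throughput i p = p i * capture i p"
proof -
  define E where "E = {\<omega> \<in> space (slot p). rx_power \<omega> i > interference \<omega> i}"
  have E: "E \<in> sets (fading \<Otimes>\<^sub>M access p)"
    using reception_event_sets[of p i] by (simp add: E_def slot_def)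
  interpret access: prob_space "access p"
    unfolding access_def by (intro prob_space_PiM measure_pmf.prob_space_axioms)
  define h where "h x = (\<Prod>j\<in>UNIV - {i}. if x j < x i then 1 else ennreal (1 - p j))" for x :: "'n \<Rightarrow> real"
  have [measurable]: "h \<in> borel_measurable fading"
    unfolding h_def fading_def by measurable
  have space: "space (slot p) = UNIV"
    by (simp add: slot_def fading_def access_def space_pair_measure space_PiM)
  \<comment> \<open>Measure the decisions for fixed gains first, then average over the
    gains.\<close>
  have "emeasure (slot p) E = (\<integral>\<^sup>+x. emeasure (access p) (Pair x -` E) \<partial>fading)"
    using access.emeasure_pair_measure_alt[OF E] by (simp add: slot_def)
  also have "\<dots> = (\<integral>\<^sup>+x. ennreal (p i) * h x \<partial>fading)"
  proof (rule nn_integral_cong_AE)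
    show "AE x in fading. emeasure (access p) (Pair x -` E) = ennreal (p i) * h x"
      using AE_fading_pos
    proof eventually_elim
      case (elim x)
      then have "Pair x -` E = {b. b i \<and> (\<forall>j. j \<noteq> i \<longrightarrow> b j \<longrightarrow> x j < x i)}"
        by (auto simp: E_def space reception_iff)
      then show ?case
        by (simp add: emeasure_access_capture[OF p] h_def)
    qed
  qed
  also have "\<dots> = ennreal (p i) * ennreal (capture i p)"
    using nn_integral_fading_survival[OF p, of i, folded h_def]
    by (simp add: nn_integral_cmult)
  also have "\<dots> = ennreal (p i * capture i p)"
    using p capture_pos[OF p, of i] by (simp add: ennreal_mult)
  finally have "measure (slot p) E = p i * capture i p"
    using p capture_pos[OF p, of i] by (simp add: measure_def mult_nonneg_nonneg)
  then show ?thesis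
    by (simp add: throughput_def E_def)
qed

section \<open>Equilibria: characterisation, uniqueness, existence\<close>

lemma nash_equilibrium_iff:
  assumes "\<forall>i. 0 \<le> \<rho> i"
  shows "nash_equilibrium \<rho> p \<longleftrightarrow> (\<forall>i. p i \<in> {0..1}) \<and> (\<forall>i. p i * capture i p = \<rho> i)"
proof (cases "\<forall>i. p i \<in> {0..1}")
  case True
  have "is_arg_min (\<lambda>t. t) (\<lambda>t. t \<in> {0..1} \<and> throughput i (p(i := t)) \<ge> \<rho> i) (p i) \<longleftrightarrow>
      p i * capture i p = \<rho> i" for i
  proof -
    have c: "0 < capture i p" by (rule capture_pos[OF True])
    have "throughput i (p(i := t)) = t * capture i p" if "t \<in> {0..1}" for t
      using True that by (subst throughput_eq) auto
    then have "is_arg_min (\<lambda>t. t) (\<lambda>t. t \<in> {0..1} \<and> throughput i (p(i := t)) \<ge> \<rho> i) (p i) \<longleftrightarrow>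
        is_arg_min (\<lambda>t. t) (\<lambda>t. t \<in> {0..1} \<and> t \<ge> \<rho> i / capture i p) (p i)"
      using c by (intro arg_cong[where f = "\<lambda>P. is_arg_min (\<lambda>t. t) P (p i)"])
        (auto simp: fun_eq_iff pos_divide_le_eq)
    \<comment> \<open>The feasible set is the interval from \<open>\<rho> i / capture i p\<close> to
      1, whose minimum is its left end; if it is empty, both sides are false because
      \<open>p i\<close> is at most 1.\<close>
    also have "\<dots> \<longleftrightarrow> p i = \<rho> i / capture i p"
    proof -
      have "0 \<le> \<rho> i / capture i p" using c assms by simp
      then show ?thesis
        using True[rule_format, of i] unfolding is_arg_min_def
        by (auto simp del: zero_le_divide_iff)
    qed
    also have "\<dots> \<longleftrightarrow> p i * capture i p = \<rho> i"
      using c by (simp add: eq_divide_eq)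
    finally show ?thesis .
  qed
  with True show ?thesis by (simp add: nash_equilibrium_def)
qed (auto simp: nash_equilibrium_def)

text \<open>Comparing ordered pairs suffices, because every equilibrium lies below the greatest
  fixed point.\<close>

lemma equilibrium_unique:
  fixes p q :: "'n::finite \<Rightarrow> real"
  assumes p: "\<forall>i. p i \<in> {0..1}" and q: "\<forall>i. q i \<in> {0..1}" and le: "\<forall>i. q i \<le> p i"
    and eq: "\<forall>i. q i * capture i q = p i * capture i p"
  shows "q = p"
proof (rule ccontr)
  assume "q \<noteq> p"
  then obtain k where k: "q k < p k"
    using le by (metis ext order_le_less)
  have prod_eq: "(\<Prod>i\<in>UNIV. 1 - q i) = (\<Prod>i\<in>UNIV. 1 - p i)"
    using sum_mult_capture[OF p] sum_mult_capture[OF q] eq by simp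
  show False
  proof (cases "\<exists>j. q j = 1")
    case True
    then obtain j where j: "q j = 1" by blast
    with le p have "p j = 1" by (metis atLeastAtMost_iff order_antisym)
    with j eq have "capture j q = capture j p" by (metis mult_1)
    moreover have "k \<noteq> j" using j k \<open>p j = 1\<close> by auto
    ultimately show False
      using capture_strict_antimono[OF p q le k, of j] by simp
  next
    case False
    \<comment> \<open>All factors \<open>1 - q j\<close> are now positive, so the strict drop at
      \<open>k\<close> survives in the product.\<close>
    with q have "q j < 1" for j by (metis atLeastAtMost_iff order_le_less)
    then have "(\<Prod>i\<in>UNIV. 1 - p i) < (\<Prod>i\<in>UNIV. 1 - q i)"
      using p le k by (intro prod_mono_strict[of k]) auto
    with prod_eq show False by simp
  qed
qed

text \<open>As in the Knaster--Tarski theorem, \<open>p\<close> is the pointwise supremum of all post-fixed points of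
  the monotone map \<open>G\<close>.\<close>

lemma greatest_capped_response:
  fixes \<rho> :: "'n::finite \<Rightarrow> real"
  assumes "\<forall>i. 0 \<le> \<rho> i"
  obtains p where "\<forall>i. p i \<in> {0..1}" "\<forall>i. p i = min 1 (\<rho> i / capture i p)"
    "\<And>q. \<forall>i. q i \<in> {0..1} \<Longrightarrow> \<forall>i. q i = min 1 (\<rho> i / capture i q) \<Longrightarrow> \<forall>i. q i \<le> p i"
proof -
  define G where "G p i = min 1 (\<rho> i / capture i p)" for p i
  define S where "S = {q. (\<forall>i. q i \<in> {0..1}) \<and> (\<forall>i. q i \<le> G q i)}"
  define p where "p i = (SUP q\<in>S. q i)" for i
  have G01: "G q i \<in> {0..1}" if "\<forall>i. q i \<in> {0..1}" for q i
    using capture_pos[OF that, of i] assms by (auto simp: G_def)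
  have G_mono: "G q i \<le> G r i"
    if "\<forall>i. q i \<in> {0..1}" "\<forall>i. r i \<in> {0..1}" "\<forall>i. q i \<le> r i" for q r i
  proof -
    \<comment> \<open>More active interferers lower the capture probability and so raise the
      required access probability.\<close>
    have "\<rho> i / capture i q \<le> \<rho> i / capture i r"
      using capture_antimono[OF that(2,1,3), of i] capture_pos[OF that(2), of i] assms
      by (intro divide_left_mono) (auto intro: mult_pos_pos)
    then show ?thesis by (auto simp: G_def)
  qed
  have "(\<lambda>_. 0) \<in> S" using G01[of "\<lambda>_. 0"] by (auto simp: S_def)
  then have ne: "S \<noteq> {}" by blast
  have upper: "q i \<le> p i" if "q \<in> S" for q i
    unfolding p_def using that by (intro cSUP_upper bdd_aboveI2[where M = 1]) (auto simp: S_def)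
  have least: "p i \<le> b" if "\<And>q. q \<in> S \<Longrightarrow> q i \<le> b" for i b
    unfolding p_def using ne that by (rule cSUP_least)
  have p01: "\<forall>i. p i \<in> {0..1}"
    using upper[OF \<open>(\<lambda>_. 0) \<in> S\<close>] by (auto intro!: least simp: S_def)
  have pG: "p i \<le> G p i" for i
  proof (rule least)
    fix q assume "q \<in> S"
    then have "q i \<le> G q i" "G q i \<le> G p i"
      using upper p01 by (auto simp: S_def intro!: G_mono)
    then show "q i \<le> G p i" by simp
  qed
  \<comment> \<open>Applying \<open>G\<close> to \<open>p i \<le> G p i\<close> shows that
    \<open>G p\<close> is post-fixed too, so it lies below the supremum \<open>p\<close>.\<close>
  have "G p \<in> S"
    using G01[OF p01] pG p01 by (auto simp: S_def intro!: G_mono)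
  then have "p i = G p i" for i
    using upper pG by (intro order_antisym)
  moreover have "\<forall>i. q i \<le> p i" if "\<forall>i. q i \<in> {0..1}" "\<forall>i. q i = G q i" for q
    using that upper[of q] by (auto simp: S_def)
  ultimately show ?thesis
    using that p01 by (auto simp: G_def)
qed

lemma capped_response_saturated:
  fixes \<rho> :: "'n::finite \<Rightarrow> real"
  assumes p: "\<forall>i. p i \<in> {0..1}" "\<forall>i. p i = min 1 (\<rho> i / capture i p)"
    and sum: "(\<Sum>i\<in>UNIV. \<rho> i) \<le> 1"
  shows "p i * capture i p = \<rho> i"
proof (rule ccontr)
  assume ne: "p i * capture i p \<noteq> \<rho> i"
  have le: "p j * capture j p \<le> \<rho> j" for j
    using p(2)[rule_format, of j] capture_pos[OF p(1), of j]
    by (metis min.cobounded2 pos_le_divide_eq)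
  \<comment> \<open>A missed demand means that the cap 1 is active in the minimum.\<close>
  have "p i = 1"
    using ne p(2)[rule_format, of i] capture_pos[OF p(1), of i]
    by (auto simp: min_def split: if_splits)
  then have "(\<Prod>j\<in>UNIV. 1 - p j) = 0" by auto
  then have "(\<Sum>j\<in>UNIV. p j * capture j p) = 1"
    by (simp add: sum_mult_capture[OF p(1)])
  moreover have "(\<Sum>j\<in>UNIV. p j * capture j p) < (\<Sum>j\<in>UNIV. \<rho> j)"
    using le ne by (intro sum_strict_mono_ex1) (auto simp: order.strict_iff_order)
  ultimately show False using sum by simp
qed

theorem theorem3:
  fixes \<rho> :: "'n::finite \<Rightarrow> real"
  assumes "\<And>i. \<rho> i \<ge> 0"
  shows "(\<exists>!p. nash_equilibrium \<rho> p) \<longleftrightarrow> (\<Sum>i\<in>UNIV. \<rho> i) \<le> 1"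
proof
  have nash: "nash_equilibrium \<rho> p \<longleftrightarrow> (\<forall>i. p i \<in> {0..1}) \<and> (\<forall>i. p i * capture i p = \<rho> i)" for p
    using assms by (intro nash_equilibrium_iff) simp
  {
    assume "\<exists>!p. nash_equilibrium \<rho> p"
    then obtain p where p: "\<forall>i. p i \<in> {0..1}" "\<forall>i. p i * capture i p = \<rho> i"
      by (auto simp: nash)
    have "(\<Sum>i\<in>UNIV. \<rho> i) = 1 - (\<Prod>i\<in>UNIV. 1 - p i)"
      using sum_mult_capture[OF p(1)] p(2) by simp
    also have "\<dots> \<le> 1" using p(1) by (auto intro!: prod_nonneg)
    finally show "(\<Sum>i\<in>UNIV. \<rho> i) \<le> 1" .
  next
    assume sum: "(\<Sum>i\<in>UNIV. \<rho> i) \<le> 1"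
    obtain p where p: "\<forall>i. p i \<in> {0..1}" "\<forall>i. p i = min 1 (\<rho> i / capture i p)"
      and greatest: "\<And>q. \<forall>i. q i \<in> {0..1} \<Longrightarrow> \<forall>i. q i = min 1 (\<rho> i / capture i q) \<Longrightarrow> \<forall>i. q i \<le> p i"
      using greatest_capped_response[of \<rho>] assms by auto
    have eq: "\<forall>i. p i * capture i p = \<rho> i"
      using capped_response_saturated[OF p sum] by blast
    show "\<exists>!p. nash_equilibrium \<rho> p"
    proof (rule ex1I)
      show "nash_equilibrium \<rho> p" using p(1) eq by (simp add: nash)
      fix q assume "nash_equilibrium \<rho> q"
      then have q: "\<forall>i. q i \<in> {0..1}" "\<forall>i. q i * capture i q = \<rho> i"
        by (simp_all add: nash)
      \<comment> \<open>At an equilibrium the ratio equals \<open>q i\<close>, which is at most 1,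
        so capping changes nothing.\<close>
      have "q i = min 1 (\<rho> i / capture i q)" for i
        using q(1)[rule_format, of i] q(2)[rule_format, of i] capture_pos[OF q(1), of i]
        by (metis atLeastAtMost_iff less_irrefl min.absorb2 nonzero_eq_divide_eq)
      then have "\<forall>i. q i \<le> p i" using greatest[OF q(1)] by blast
      then show "q = p" using p(1) q eq by (intro equilibrium_unique) simp_all
    qed
  }
qed

end
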